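(* Let $\psi_{AB}$ be a bipartite state on finite-dimensional systems with purification $|\psi_{ABE}\rangle$. Define the maximum coherent information assisted by an erasure channel $$D^{(1)}_E(\psi_{AB}) := \sup_{A\hookrightarrow a\alpha} I(a\rangle BB')_{\omega_{aBB'}},\qquad \omega_{aBB'} := (\mathrm{id}_{aB}\otimes\Lambda_E)(\psi_{a\alpha B}),$$ where the supremum is over all isometries $A\hookrightarrow a\alpha$, $\psi_{a\alpha B}$ is the resulting state, and $\Lambda_E:\alpha\to B'$ is the erasure channel. Then $$D^{(1)}_E(\psi_{AB}) = W^{(1)}_{\mathrm{ind},\emptyset}(\psi_{AB}) = \sup_{A\hookrightarrow a\alpha}\frac12\left(I(a:B)-I(a:E)\right),$$ where the entropic quantities on the right are evaluated on the state obtained from $|\psi_{ABE}\rangle$ by applying the isometry $A\hookrightarrow a\alpha$.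
   Context: All Hilbert spaces are finite-dimensional, with $a$ and $\alpha$ of arbitrary dimension. $S$ is the von Neumann entropy, $I(X:Y)=S(X)+S(Y)-S(XY)$ is the mutual information, and $I(X\rangle Y)=S(Y)-S(XY)$ is the coherent information. The (fifty-fifty) erasure channel on a $d$-dimensional system $\alpha$ outputs a $(d+1)$-dimensional system $B'$, with $\Lambda_E(\rho)=\frac12\rho+\frac12|e\rangle\langle e|$, where $|e\rangle$ is an erasure flag orthogonal to the input space. The quantity $W^{(1)}_{\mathrm{ind},\emptyset}$ (single-copy zero-way weak mutual independence) is defined by $W^{(1)}_{\mathrm{ind},\emptyset}(\psi_{AB}):=\sup_{A\hookrightarrow a\alpha}\frac12(I(a:B)-I(a:E))$, the supremum being over all isometries mapping $A$ to $a\alpha$. *)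

theory Defs
  imports
    "Jordan_Normal_Form.Spectral_Radius"
    "Jordan_Normal_Form.Schur_Decomposition"
    "HOL-Library.Extended_Real"
begin

text \<open>
  A system of dimension \<open>d\<close> is \<open>\<complex>\<^sup>d\<close> with its standard basis; dimensions are ordinary natural numbers,
  so that suprema can range over them. Composite systems are flattened in row-major order:
  in \<open>X \<otimes> Y\<close> the basis vector \<open>|x\<rangle>|y\<rangle>\<close> has index \<open>x * dim Y + y\<close>, which makes the encoding
  of \<open>\<otimes>\<close> strictly associative.
\<close>

definition mat_trace :: "complex mat \<Rightarrow> complex" where
  "mat_trace M = (\<Sum>i<dim_row M. M $$ (i, i))"

definition tensor_mat :: "complex mat \<Rightarrow> complex mat \<Rightarrow> complex mat" where
  "tensor_mat M N = mat (dim_row M * dim_row N) (dim_col M * dim_col N)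
     (\<lambda>(i, j). M $$ (i div dim_row N, j div dim_col N) * N $$ (i mod dim_row N, j mod dim_col N))"

definition proj_mat :: "complex vec \<Rightarrow> complex mat" where
  "proj_mat v = mat (dim_vec v) (dim_vec v) (\<lambda>(i, j). v $ i * cnj (v $ j))"

definition density_operator :: "nat \<Rightarrow> complex mat \<Rightarrow> bool" where
  "density_operator d \<rho> \<longleftrightarrow>
     \<rho> \<in> carrier_mat d d \<and> mat_adjoint \<rho> = \<rho> \<and>
     (\<forall>v\<in>carrier_vec d. 0 \<le> (\<rho> *\<^sub>v v) \<bullet>c v) \<and> mat_trace \<rho> = 1"

text \<open>
  \<open>S(\<rho>) = - Tr (\<rho> log \<rho>)\<close>, evaluated on the spectrum counted with multiplicity. The convention
  \<open>0 log 0 = 0\<close> is automatic, since \<open>log 2 0 = 0\<close>.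
\<close>

definition vn_entropy :: "complex mat \<Rightarrow> real" where
  "vn_entropy \<rho> = - (\<Sum>\<mu>\<in>spectrum \<rho>.
     real (Polynomial.order \<mu> (char_poly \<rho>)) * (Re \<mu> * log 2 (Re \<mu>)))"

text \<open>
  Trace over the middle factor of \<open>X \<otimes> Y \<otimes> Z\<close>. A partial trace over the first or last
  factor is the case in which \<open>X\<close> or \<open>Z\<close> has dimension 1.
\<close>

definition ptrace :: "nat \<Rightarrow> nat \<Rightarrow> nat \<Rightarrow> complex mat \<Rightarrow> complex mat" where
  "ptrace dX dY dZ M = mat (dX * dZ) (dX * dZ)
     (\<lambda>(i, j). \<Sum>y<dY. M $$ (((i div dZ) * dY + y) * dZ + i mod dZ,
                            ((j div dZ) * dY + y) * dZ + j mod dZ))"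

definition coherent_information :: "nat \<Rightarrow> nat \<Rightarrow> complex mat \<Rightarrow> real" where
  "coherent_information dX dY \<rho> = vn_entropy (ptrace 1 dX dY \<rho>) - vn_entropy \<rho>"

definition mutual_information :: "nat \<Rightarrow> nat \<Rightarrow> complex mat \<Rightarrow> real" where
  "mutual_information dX dY \<rho> =
     vn_entropy (ptrace dX dY 1 \<rho>) + vn_entropy (ptrace 1 dX dY \<rho>) - vn_entropy \<rho>"

text \<open>
  The superoperator \<open>id\<^sub>X \<otimes> \<Lambda> \<otimes> id\<^sub>Z\<close> for a linear map \<open>\<Lambda>\<close> from \<open>d \<times> d\<close> to \<open>d' \<times> d'\<close> matrices: \<open>\<Lambda>\<close> is
  applied to each block \<open>(\<langle>x| \<otimes> 1 \<otimes> \<langle>z|) M (|x'\<rangle> \<otimes> 1 \<otimes> |z'\<rangle>)\<close>.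
\<close>

definition apply_middle ::
  "nat \<Rightarrow> nat \<Rightarrow> nat \<Rightarrow> nat \<Rightarrow> (complex mat \<Rightarrow> complex mat) \<Rightarrow> complex mat \<Rightarrow> complex mat" where
  "apply_middle dX d d' dZ \<Lambda> M = mat (dX * d' * dZ) (dX * d' * dZ)
     (\<lambda>(i, j). \<Lambda> (mat d d (\<lambda>(k, l).
          M $$ (((i div dZ div d') * d + k) * dZ + i mod dZ,
                ((j div dZ div d') * d + l) * dZ + j mod dZ)))
        $$ (i div dZ mod d', j div dZ mod d'))"

text \<open>
  The flag \<open>|e\<rangle>\<close> is the last basis vector of the output space. The factor \<open>Tr \<rho>\<close> is the linear
  extension from density operators to all matrices.
\<close>

definition erasure_channel :: "nat \<Rightarrow> complex mat \<Rightarrow> complex mat" where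
  "erasure_channel d \<rho> =
     (1 / 2) \<cdot>\<^sub>m four_block_mat \<rho> (0\<^sub>m d 1) (0\<^sub>m 1 d) (0\<^sub>m 1 1)
     + (mat_trace \<rho> / 2) \<cdot>\<^sub>m proj_mat (unit_vec (d + 1) d)"

text \<open>
  All isometries from \<open>A\<close> to \<open>a \<otimes> \<alpha>\<close>, for all dimensions of \<open>a\<close> and \<open>\<alpha>\<close>.
\<close>

definition splittings :: "nat \<Rightarrow> (nat \<times> nat \<times> complex mat) set" where
  "splittings dA = {(da, d\<alpha>, V).
     V \<in> carrier_mat (da * d\<alpha>) dA \<and> mat_adjoint V * V = 1\<^sub>m dA}"

definition split_state :: "nat \<Rightarrow> complex mat \<Rightarrow> complex mat \<Rightarrow> complex mat" where
  "split_state dB V \<rho> =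
     (let U = tensor_mat V (1\<^sub>m dB) in U * \<rho> * mat_adjoint U)"

text \<open>
  The state below is ordered as \<open>a B' B\<close> rather than \<open>a B B'\<close>, because \<open>\<alpha>\<close> sits between \<open>a\<close> and \<open>B\<close>.
\<close>

definition erasure_output ::
  "nat \<Rightarrow> nat \<Rightarrow> nat \<Rightarrow> complex mat \<Rightarrow> complex mat \<Rightarrow> complex mat" where
  "erasure_output dB da d\<alpha> V \<rho> =
     apply_middle da d\<alpha> (d\<alpha> + 1) dB (erasure_channel d\<alpha>) (split_state dB V \<rho>)"

definition D_erasure :: "nat \<Rightarrow> nat \<Rightarrow> complex mat \<Rightarrow> ereal" where
  "D_erasure dA dB \<rho> = (SUP (da, d\<alpha>, V)\<in>splittings dA.
     ereal (coherent_information da ((d\<alpha> + 1) * dB) (erasure_output dB da d\<alpha> V \<rho>)))"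

definition purification :: "nat \<Rightarrow> nat \<Rightarrow> nat \<Rightarrow> complex vec \<Rightarrow> complex mat \<Rightarrow> bool" where
  "purification dA dB dE \<psi> \<rho> \<longleftrightarrow>
     \<psi> \<in> carrier_vec (dA * dB * dE) \<and> ptrace (dA * dB) dE 1 (proj_mat \<psi>) = \<rho>"

definition split_pure :: "nat \<Rightarrow> nat \<Rightarrow> complex mat \<Rightarrow> complex vec \<Rightarrow> complex mat" where
  "split_pure dB dE V \<psi> = proj_mat (tensor_mat V (1\<^sub>m (dB * dE)) *\<^sub>v \<psi>)"

text \<open>Marginals of a state on \<open>a \<otimes> \<alpha> \<otimes> B \<otimes> E\<close>.\<close>

definition marginal_aB :: "nat \<Rightarrow> nat \<Rightarrow> nat \<Rightarrow> nat \<Rightarrow> complex mat \<Rightarrow> complex mat" where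
  "marginal_aB da d\<alpha> dB dE \<omega> = ptrace (da * dB) dE 1 (ptrace da d\<alpha> (dB * dE) \<omega>)"

definition marginal_aE :: "nat \<Rightarrow> nat \<Rightarrow> nat \<Rightarrow> nat \<Rightarrow> complex mat \<Rightarrow> complex mat" where
  "marginal_aE da d\<alpha> dB dE \<omega> = ptrace da (d\<alpha> * dB) dE \<omega>"

definition half_information_gap ::
  "nat \<Rightarrow> nat \<Rightarrow> nat \<Rightarrow> nat \<Rightarrow> complex mat \<Rightarrow> real" where
  "half_information_gap da d\<alpha> dB dE \<omega> =
     1 / 2 * (mutual_information da dB (marginal_aB da d\<alpha> dB dE \<omega>)
            - mutual_information da dE (marginal_aE da d\<alpha> dB dE \<omega>))"

text \<open>
  This is a function of the bipartite state alone, so an arbitrary purification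
  \<open>p = (dim E, |\<psi>\<^sub>A\<^sub>B\<^sub>E\<rangle>)\<close> is chosen.
\<close>

definition W_ind :: "nat \<Rightarrow> nat \<Rightarrow> complex mat \<Rightarrow> ereal" where
  "W_ind dA dB \<rho> =
     (let (dE, \<psi>) = (SOME p. purification dA dB (fst p) (snd p) \<rho>)
      in SUP (da, d\<alpha>, V)\<in>splittings dA.
           ereal (half_information_gap da d\<alpha> dB dE (split_pure dB dE V \<psi>)))"

end

theory Submission
  imports Defs
begin

text \<open>
  The two suprema agree term by term, for each \<open>V\<close> and each purification. With probability \<open>1/2\<close>
  each, the erasure channel delivers \<open>\<alpha>\<close> or the flag, so up to the contribution of the binary mixture, which cancels,
  \<open>S(BB') = (S(\<alpha>B) + S(B)) / 2\<close> and \<open>S(aBB') = (S(a\<alpha>B) + S(aB)) / 2\<close>. The global state is pure, so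
  \<open>S(\<alpha>B) = S(aE)\<close> and \<open>S(a\<alpha>B) = S(E)\<close>, and
  \<open>I(a\<rangle>BB') = (S(aE) + S(B) - S(E) - S(aB)) / 2 = (I(a:B) - I(a:E)) / 2\<close>.
\<close>

section \<open>Entropy and characteristic polynomials\<close>

text \<open>The order of a root of \<open>p as\<close> is its number of occurrences in
  \<open>as\<close>. Entropies thereby become sums over eigenvalue lists, in which padding,
  concatenation and scaling of spectra are plain list operations.\<close>

lemma root_sum_linear_factors:
  fixes g :: "complex \<Rightarrow> real"
  defines "p \<equiv> \<lambda>as. \<Prod>a\<leftarrow>as. [:- a, 1:]"
  shows "(\<Sum>\<mu> | poly (p as) \<mu> = 0. real (order \<mu> (p as)) * g \<mu>) = (\<Sum>a\<leftarrow>as. g a)"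
proof -
  have nz: "p as \<noteq> 0" for as
    by (auto simp: p_def prod_list_zero_iff)
  have ord: "order a (p as) = count_list as a" for a as
  proof (induction as)
    case (Cons b as)
    have "order a [:- b, 1:] = (if a = b then 1 else 0)"
      using order_linear_power[of a "- b" 1] by auto
    then show ?case
      using order_mult[of "[:- b, 1:]" "p as" a] nz[of "b # as"] Cons by (simp add: p_def)
  qed (simp add: p_def)
  have "{\<mu>. poly (p as) \<mu> = 0} = set as"
    by (simp add: order_root nz ord count_list_0_iff)
  \<comment> \<open>The index set is an arbitrary finite superset of \<open>set as\<close>, so that
    it can stay fixed while the induction shortens the list.\<close>
  moreover have "(\<Sum>\<mu>\<in>S. real (count_list as \<mu>) * g \<mu>) = (\<Sum>a\<leftarrow>as. g a)"
    if "finite S" "set as \<subseteq> S" for S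
    using that(2)
  proof (induction as)
    case (Cons a as)
    have "real (count_list (a # as) \<mu>) * g \<mu>
        = (if \<mu> = a then g \<mu> else 0) + real (count_list as \<mu>) * g \<mu>" for \<mu>
      by (simp add: algebra_simps)
    then show ?case using Cons \<open>finite S\<close> by (simp only: sum.distrib) auto
  qed simp
  ultimately show ?thesis
    by (simp add: ord)
qed

lemma vn_entropy_char_poly:
  assumes A: "A \<in> carrier_mat n n"
  shows "vn_entropy A = - (\<Sum>\<mu> | poly (char_poly A) \<mu> = 0.
    real (order \<mu> (char_poly A)) * (Re \<mu> * log 2 (Re \<mu>)))"
proof -
  have "spectrum A = {\<mu>. poly (char_poly A) \<mu> = 0}"
    by (auto simp: spectrum_def eigenvalue_root_char_poly[OF A])
  then show ?thesis by (simp add: vn_entropy_def)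
qed

lemma vn_entropy_char_poly_factors:
  assumes "A \<in> carrier_mat n n" and "char_poly A = (\<Prod>a\<leftarrow>as. [:- a, 1:])"
  shows "vn_entropy A = - (\<Sum>a\<leftarrow>as. Re a * log 2 (Re a))"
  by (simp only: vn_entropy_char_poly[OF assms(1)] assms(2) root_sum_linear_factors)

lemma vn_entropy_char_poly_cong:
  assumes "A \<in> carrier_mat n n" "B \<in> carrier_mat m m" and "char_poly A = char_poly B"
  shows "vn_entropy A = vn_entropy B"
  by (simp only: vn_entropy_char_poly[OF assms(1)] vn_entropy_char_poly[OF assms(2)] assms(3))

text \<open>The monomials are products of linear factors with root 0. They only pad the eigenvalue
  lists with zeros, and each zero contributes \<open>0 * log 2 0 = 0\<close>.\<close>

lemma vn_entropy_char_poly_monom: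
  assumes A: "A \<in> carrier_mat n n" and B: "B \<in> carrier_mat m m"
    and eq: "monom 1 k * char_poly A = monom 1 l * char_poly B"
  shows "vn_entropy A = vn_entropy B"
proof -
  obtain as bs where as: "char_poly A = (\<Prod>a\<leftarrow>as. [:- a, 1:])"
    and bs: "char_poly B = (\<Prod>a\<leftarrow>bs. [:- a, 1:])"
    using char_poly_factorized[OF A] char_poly_factorized[OF B] by auto
  have "(\<Prod>a\<leftarrow>replicate k 0 @ as. [:- a, 1:]) = (\<Prod>a\<leftarrow>replicate l 0 @ bs. [:- a, 1:])"
    using eq by (simp add: as bs monom_altdef)
  then have "(\<Sum>a\<leftarrow>replicate k 0 @ as. Re a * log 2 (Re a)) = (\<Sum>a\<leftarrow>replicate l 0 @ bs. Re a * log 2 (Re a))"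
    by (simp only: root_sum_linear_factors[symmetric])
  then show ?thesis
    by (simp add: vn_entropy_char_poly_factors[OF A as] vn_entropy_char_poly_factors[OF B bs] sum_list_replicate)
qed

text \<open>Sylvester's determinant identity as an identity of polynomials: \<open>A * B\<close> and
  \<open>B * A\<close> have the same nonzero spectrum with multiplicity, and the monomials make up
  for the different sizes.\<close>

lemma char_poly_mult_swap:
  fixes A B :: "'a :: idom mat"
  assumes A: "A \<in> carrier_mat m n" and B: "B \<in> carrier_mat n m"
  shows "monom 1 n * char_poly (A * B) = monom 1 m * char_poly (B * A)"
proof -
  let ?x = "[:0, 1:] :: 'a poly"
  let ?c = "map_mat (\<lambda>a. [:a:])"
  let ?K = "four_block_mat (?x \<cdot>\<^sub>m 1\<^sub>m m) (?c A) (?c B) (1\<^sub>m n)"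
  \<comment> \<open>The determinant of \<open>?K\<close> is found in two ways, by clearing its lower left block
    with a column operation (\<open>?L\<close>) and with a row operation (\<open>?R\<close>).\<close>
  let ?L = "four_block_mat (1\<^sub>m m) (0\<^sub>m m n) (- ?c B) (1\<^sub>m n)"
  let ?R = "four_block_mat (1\<^sub>m m) (0\<^sub>m m n) (- ?c B) (?x \<cdot>\<^sub>m 1\<^sub>m n)"
  have cA: "?c A \<in> carrier_mat m n" and cB: "?c B \<in> carrier_mat n m"
    using A B by auto
  have hom: "?c (X * Y) = ?c X * ?c Y" if "X \<in> carrier_mat k l" "Y \<in> carrier_mat l p"
    for X Y :: "'a mat" and k l p
  proof (rule eq_matI)
    fix i j assume "i < dim_row (?c X * ?c Y)" "j < dim_col (?c X * ?c Y)"
    then show "?c (X * Y) $$ (i, j) = (?c X * ?c Y) $$ (i, j)"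
      using that by (simp add: scalar_prod_def poly_eq_iff coeff_sum
        coeff_pCons mult.commute split: nat.split)
  qed (use that in auto)
  have cpAB: "char_poly (A * B) = det (?x \<cdot>\<^sub>m 1\<^sub>m m + - (?c A * ?c B))"
    unfolding char_poly_defs hom[OF A B, symmetric]
    by (rule arg_cong[of _ _ det]) (use A B in \<open>auto intro!: eq_matI\<close>)
  have cpBA: "char_poly (B * A) = det (?x \<cdot>\<^sub>m 1\<^sub>m n + - (?c B * ?c A))"
    unfolding char_poly_defs hom[OF B A, symmetric]
    by (rule arg_cong[of _ _ det]) (use A B in \<open>auto intro!: eq_matI\<close>)
  have KL: "?K * ?L = four_block_mat (?x \<cdot>\<^sub>m 1\<^sub>m m + - (?c A * ?c B)) (?c A) (0\<^sub>m n m) (1\<^sub>m n)"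
    by (subst mult_four_block_mat[of _ m m _ n _ n _ _ m _ n]) (use cA cB in auto)
  have RK: "?R * ?K = four_block_mat (?x \<cdot>\<^sub>m 1\<^sub>m m) (?c A) (0\<^sub>m n m) (?x \<cdot>\<^sub>m 1\<^sub>m n + - (?c B * ?c A))"
    by (subst mult_four_block_mat[of _ m m _ n _ n _ _ m _ n]) (use cA cB in \<open>auto intro!: eq_matI\<close>)
  have dK: "det ?K = char_poly (A * B)"
  proof -
    have "det ?K * det ?L = det (?K * ?L)"
      by (rule det_mult[symmetric]) (use cA cB in auto)
    also have "\<dots> = char_poly (A * B)"
      unfolding KL cpAB by (subst det_four_block_mat_lower_left_zero) (use cA cB in auto)
    also have "det ?L = 1"
      by (subst det_four_block_mat_upper_right_zero) (use cA cB in auto)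
    finally show ?thesis by simp
  qed
  have "monom 1 n * det ?K = det ?R * det ?K"
    by (subst det_four_block_mat_upper_right_zero) (use cB in \<open>auto simp: det_smult monom_altdef\<close>)
  also have "\<dots> = det (?R * ?K)"
    by (rule det_mult[symmetric]) (use cA cB in auto)
  also have "\<dots> = monom 1 m * char_poly (B * A)"
    unfolding RK cpBA
    by (subst det_four_block_mat_lower_left_zero) (use cA cB in \<open>auto simp: det_smult monom_altdef\<close>)
  finally show ?thesis unfolding dK .
qed

text \<open>
  With \<open>g\<close> the amplitudes of a pure state and \<open>G\<close> their matrix, the two marginals are \<open>G G\<^sup>*\<close> and the
  transpose of \<open>G\<^sup>* G\<close>.
\<close>

lemma vn_entropy_complementary:
  "vn_entropy (mat m m (\<lambda>(i, j). \<Sum>k<n. g i k * cnj (g j k)))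
    = vn_entropy (mat n n (\<lambda>(k, l). \<Sum>i<m. g i k * cnj (g i l)))"
proof -
  let ?A = "mat m n (\<lambda>(i, k). g i k)" and ?B = "mat n m (\<lambda>(k, j). cnj (g j k))"
  let ?C = "mat n n (\<lambda>(k, l). \<Sum>i<m. g i k * cnj (g i l))"
  have "?A * ?B = mat m m (\<lambda>(i, j). \<Sum>k<n. g i k * cnj (g j k))"
    by (rule eq_matI) (auto simp: scalar_prod_def atLeast0LessThan)
  moreover have "?B * ?A = transpose_mat ?C"
    by (rule eq_matI) (auto simp: scalar_prod_def atLeast0LessThan mult.commute)
  moreover have "vn_entropy (?A * ?B) = vn_entropy (?B * ?A)"
    by (rule vn_entropy_char_poly_monom[of _ m _ n]) (auto intro!: char_poly_mult_swap)
  moreover have "vn_entropy (transpose_mat ?C) = vn_entropy ?C"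
    by (rule vn_entropy_char_poly_cong[OF _ _ char_poly_transpose_mat]) auto
  ultimately show ?thesis by simp
qed

text \<open>The characteristic polynomial of a direct sum is the product of those of the blocks, so
  the eigenvalue lists are concatenated.\<close>

lemma vn_entropy_block_diag:
  assumes A: "A \<in> carrier_mat n n" and B: "B \<in> carrier_mat m m"
  shows "vn_entropy (four_block_mat A (0\<^sub>m n m) (0\<^sub>m m n) B) = vn_entropy A + vn_entropy B"
proof -
  obtain as bs where as: "char_poly A = (\<Prod>a\<leftarrow>as. [:- a, 1:])"
    and bs: "char_poly B = (\<Prod>a\<leftarrow>bs. [:- a, 1:])"
    using char_poly_factorized[OF A] char_poly_factorized[OF B] by auto
  have "char_poly (four_block_mat A (0\<^sub>m n m) (0\<^sub>m m n) B) = char_poly A * char_poly B"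
    by (rule char_poly_0_block[OF refl]) (use as bs A B in auto)
  then have "char_poly (four_block_mat A (0\<^sub>m n m) (0\<^sub>m m n) B) = (\<Prod>a\<leftarrow>as @ bs. [:- a, 1:])"
    by (simp add: as bs)
  from vn_entropy_char_poly_factors[OF _ this, of "n + m"]
    vn_entropy_char_poly_factors[OF A as] vn_entropy_char_poly_factors[OF B bs] A B
  show ?thesis by simp
qed

section \<open>Trace and entropy under scaling by one half\<close>

lemma mat_trace_mult_swap:
  assumes "A \<in> carrier_mat m n" "B \<in> carrier_mat n m"
  shows "mat_trace (A * B) = mat_trace (B * A)"
proof -
  have "mat_trace (A * B) = (\<Sum>i<m. \<Sum>k<n. A $$ (i, k) * B $$ (k, i))"
    using assms by (auto simp: mat_trace_def scalar_prod_def atLeast0LessThan)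
  also have "\<dots> = (\<Sum>k<n. \<Sum>i<m. B $$ (k, i) * A $$ (i, k))"
    by (subst sum.swap) (simp add: mult.commute)
  also have "\<dots> = mat_trace (B * A)"
    using assms by (auto simp: mat_trace_def scalar_prod_def atLeast0LessThan)
  finally show ?thesis .
qed

text \<open>Each eigenvalue is halved, and the extra term from \<open>log 2 (1 / 2)\<close> adds up
  to half the trace. This trace term is the contribution of the binary mixture.\<close>

lemma vn_entropy_half:
  assumes A: "A \<in> carrier_mat n n"
  shows "vn_entropy ((1 / 2) \<cdot>\<^sub>m A) = vn_entropy A / 2 + Re (mat_trace A) / 2"
proof -
  obtain as where as: "char_poly A = (\<Prod>a\<leftarrow>as. [:- a, 1:])"
    using char_poly_factorized[OF A] by auto
  \<comment> \<open>The triangular Schur form has the eigenvalues on its diagonal. It gives both the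
    trace of \<open>A\<close> as their sum and the spectrum of the halved matrix.\<close>
  obtain B P Q where "schur_decomposition A as = (B, P, Q)"
    by (cases "schur_decomposition A as") auto
  from schur_decomposition[OF A as this]
  have wit: "similar_mat_wit A B P Q" and ut: "upper_triangular B" and diag: "diag_mat B = as"
    by auto
  note w = similar_mat_witD2[OF A wit]
  have B: "B \<in> carrier_mat n n" using w by auto
  have "mat_trace A = mat_trace (P * (B * Q))"
    using w by (simp add: assoc_mult_mat[of _ n n _ n _ n])
  also have "\<dots> = mat_trace (B * Q * P)"
    by (rule mat_trace_mult_swap[of _ n n]) (use w in auto)
  also have "B * Q * P = B"
    using w by (simp add: assoc_mult_mat[of _ n n _ n _ n])
  also have "mat_trace B = sum_list as"
    using B unfolding diag[symmetric] diag_mat_def mat_trace_def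
    by (simp add: sum_list_distinct_conv_sum_set atLeast0LessThan)
  moreover have "Re (sum_list as) = (\<Sum>a\<leftarrow>as. Re a)" for as
    by (induction as) auto
  ultimately have tr: "Re (mat_trace A) = (\<Sum>a\<leftarrow>as. Re a)"
    by simp
  have "similar_mat ((1 / 2) \<cdot>\<^sub>m A) ((1 / 2) \<cdot>\<^sub>m B)"
    using wit by (intro similar_mat_smult) (auto simp: similar_mat_def)
  from char_poly_similar[OF this]
  have "char_poly ((1 / 2) \<cdot>\<^sub>m A) = (\<Prod>a\<leftarrow>diag_mat ((1 / 2) \<cdot>\<^sub>m B). [:- a, 1:])"
    using B ut by (subst (asm) (2) char_poly_upper_triangular[of _ n]) (auto simp: upper_triangular_def)
  also have "diag_mat ((1 / 2) \<cdot>\<^sub>m B) = map (\<lambda>a. a / 2) as"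
    using B unfolding diag[symmetric] by (auto simp: diag_mat_def)
  finally have cp: "char_poly ((1 / 2) \<cdot>\<^sub>m A) = (\<Prod>a\<leftarrow>map (\<lambda>a. a / 2) as. [:- a, 1:])" .
  \<comment> \<open>No sign condition on \<open>Re a\<close>: in HOL \<open>ln x = ln \<bar>x\<bar>\<close> and \<open>ln 0 = 0\<close>.\<close>
  have eq: "Re a / 2 * log 2 (Re a / 2) = Re a * log 2 (Re a) / 2 - Re a / 2" for a
    by (simp add: log_divide algebra_simps)
  have "vn_entropy ((1 / 2) \<cdot>\<^sub>m A) = - (\<Sum>a\<leftarrow>as. Re a / 2 * log 2 (Re a / 2))"
    using vn_entropy_char_poly_factors[OF _ cp, of n] A by (simp add: o_def)
  also have "\<dots> = - (\<Sum>a\<leftarrow>as. Re a * log 2 (Re a)) / 2 + (\<Sum>a\<leftarrow>as. Re a) / 2"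
    unfolding eq by (induction as) (auto simp: field_simps)
  finally show ?thesis
    unfolding tr vn_entropy_char_poly_factors[OF A as] .
qed

section \<open>Matrix entries of partial traces and split states\<close>

lemma index_less: "x < a \<Longrightarrow> y < b \<Longrightarrow> x * b + y < a * b" for a b x y :: nat
  by (metis add_less_cancel_left less_le_trans mult_Suc add.commute mult_le_mono1 Suc_leI)

lemma index_cases:
  fixes a b i :: nat
  assumes "i < a * b"
  obtains x y where "x < a" "y < b" "i = x * b + y"
proof
  show "i mod b < b" using assms by (cases b) auto
  show "i div b < a" using assms by (simp add: less_mult_imp_div_less)
qed simp

text \<open>Both groupings of a threefold tensor product lead to the same flat index, so rewriting
  with this equation changes the grouping of factors without any permutation.\<close>

lemma index_assoc: "x * (b * c) + (y * c + z) = (x * b + y) * c + z" for x y z b c :: nat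
  by (simp add: algebra_simps)

lemma sum_index_split:
  "(\<Sum>i<m + n. h i) = (\<Sum>i<m. h i) + (\<Sum>i<n. h (m + i))" for m n :: nat
  by (induction n) (auto simp: add.assoc)

lemma sum_index: "(\<Sum>i<a * b. h i) = (\<Sum>x<a. \<Sum>y<b. h (x * b + y))" for a b :: nat
proof (induction a)
  case (Suc a)
  then show ?case
    using sum_index_split[of h "a * b" b] by (simp add: add.commute)
qed simp

section \<open>Entries of partial traces and of the marginals\<close>

lemma ptrace_carrier [simp]: "ptrace dX dY dZ M \<in> carrier_mat (dX * dZ) (dX * dZ)"
  by (simp add: ptrace_def)

lemma ptrace_dim [simp]:
  "dim_row (ptrace dX dY dZ M) = dX * dZ" "dim_col (ptrace dX dY dZ M) = dX * dZ"
  by (simp_all add: ptrace_def)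

lemma ptrace_index:
  assumes "x < dX" "x' < dX" "z < dZ" "z' < dZ"
  shows "ptrace dX dY dZ M $$ (x * dZ + z, x' * dZ + z')
    = (\<Sum>y<dY. M $$ ((x * dY + y) * dZ + z, (x' * dY + y) * dZ + z'))"
  using assms index_less[of x dX z dZ] index_less[of x' dX z' dZ] by (simp add: ptrace_def)

lemma ptrace_index_first:
  assumes "z < dZ" "z' < dZ"
  shows "ptrace 1 dY dZ M $$ (z, z') = (\<Sum>y<dY. M $$ (y * dZ + z, y * dZ + z'))"
  using ptrace_index[of 0 1 0 z dZ z' dY M] assms by simp

lemma ptrace_index_last:
  assumes "x < dX" "x' < dX"
  shows "ptrace dX dY 1 M $$ (x, x') = (\<Sum>y<dY. M $$ (x * dY + y, x' * dY + y))"
  using ptrace_index[of x dX x' 0 1 0 dY M] assms by simp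

lemma mat_trace_ptrace_first:
  assumes "M \<in> carrier_mat (dY * dZ) (dY * dZ)"
  shows "mat_trace (ptrace 1 dY dZ M) = mat_trace M"
proof -
  have "mat_trace (ptrace 1 dY dZ M) = (\<Sum>z<dZ. \<Sum>y<dY. M $$ (y * dZ + z, y * dZ + z))"
    by (simp add: mat_trace_def ptrace_index_first[unfolded One_nat_def])
  also have "\<dots> = mat_trace M"
    using assms by (subst sum.swap) (simp add: mat_trace_def sum_index)
  finally show ?thesis .
qed

lemma marginal_aE_index:
  assumes "\<Psi> \<in> carrier_vec (da * d\<alpha> * dB * dE)" "x < da" "x' < da" "e < dE" "e' < dE"
  shows "marginal_aE da d\<alpha> dB dE (proj_mat \<Psi>) $$ (x * dE + e, x' * dE + e')
    = (\<Sum>k<d\<alpha>. \<Sum>b<dB. \<Psi> $ (((x * d\<alpha> + k) * dB + b) * dE + e)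
        * cnj (\<Psi> $ (((x' * d\<alpha> + k) * dB + b) * dE + e')))"
  using assms unfolding marginal_aE_def
  by (subst ptrace_index) (auto simp: sum_index index_assoc proj_mat_def index_less)

lemma marginal_aB_index:
  assumes "\<Psi> \<in> carrier_vec (da * d\<alpha> * dB * dE)" "x < da" "x' < da" "b < dB" "b' < dB"
  shows "marginal_aB da d\<alpha> dB dE (proj_mat \<Psi>) $$ (x * dB + b, x' * dB + b')
    = (\<Sum>e<dE. \<Sum>k<d\<alpha>. \<Psi> $ (((x * d\<alpha> + k) * dB + b) * dE + e)
        * cnj (\<Psi> $ (((x' * d\<alpha> + k) * dB + b') * dE + e)))"
proof -
  have "marginal_aB da d\<alpha> dB dE (proj_mat \<Psi>) $$ (x * dB + b, x' * dB + b')
    = (\<Sum>e<dE. ptrace da d\<alpha> (dB * dE) (proj_mat \<Psi>)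
        $$ (x * (dB * dE) + (b * dE + e), x' * (dB * dE) + (b' * dE + e)))"
    using assms unfolding marginal_aB_def
    by (subst ptrace_index_last) (auto simp: index_less index_assoc)
  also have "\<dots> = (\<Sum>e<dE. \<Sum>k<d\<alpha>. \<Psi> $ (((x * d\<alpha> + k) * dB + b) * dE + e)
        * cnj (\<Psi> $ (((x' * d\<alpha> + k) * dB + b') * dE + e)))"
    using assms
    by (intro sum.cong refl, subst ptrace_index) (auto simp: index_less index_assoc proj_mat_def)
  finally show ?thesis .
qed

section \<open>Entries of the erasure channel output\<close>

lemma erasure_channel_index:
  assumes "X \<in> carrier_mat d d" "i < d + 1" "j < d + 1"
  shows "erasure_channel d X $$ (i, j) = (if i < d \<and> j < d then X $$ (i, j) / 2
    else if i = d \<and> j = d then mat_trace X / 2 else 0)"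
  using assms by (auto simp: erasure_channel_def proj_mat_def)

lemma apply_middle_index:
  assumes "x < dX" "x' < dX" "k < d'" "k' < d'" "z < dZ" "z' < dZ"
  shows "apply_middle dX d d' dZ \<Lambda> M $$ ((x * d' + k) * dZ + z, (x' * d' + k') * dZ + z')
    = \<Lambda> (mat d d (\<lambda>(l, l'). M $$ ((x * d + l) * dZ + z, (x' * d + l') * dZ + z'))) $$ (k, k')"
  using assms by (simp add: apply_middle_def index_less)

text \<open>The flag index \<open>k = d\<alpha>\<close> has no coherence with the other values. On
  each block the trace in the linear extension of the channel becomes the partial trace over
  \<alpha>.\<close>

lemma erasure_output_index:
  fixes V \<rho> :: "complex mat"
  assumes "x < da" "x' < da" "k < d\<alpha> + 1" "k' < d\<alpha> + 1" "b < dB" "b' < dB"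
  defines "\<sigma> \<equiv> split_state dB V \<rho>"
  shows "erasure_output dB da d\<alpha> V \<rho> $$ ((x * (d\<alpha> + 1) + k) * dB + b, (x' * (d\<alpha> + 1) + k') * dB + b')
    = (if k < d\<alpha> \<and> k' < d\<alpha> then \<sigma> $$ ((x * d\<alpha> + k) * dB + b, (x' * d\<alpha> + k') * dB + b') / 2
       else if k = d\<alpha> \<and> k' = d\<alpha>
       then (\<Sum>l<d\<alpha>. \<sigma> $$ ((x * d\<alpha> + l) * dB + b, (x' * d\<alpha> + l) * dB + b')) / 2 else 0)"
  unfolding erasure_output_def apply_middle_index[OF assms(1-6)] \<sigma>_def
  by (subst erasure_channel_index) (use assms in \<open>auto simp: mat_trace_def\<close>)

section \<open>Action of the splitting matrix on the purification\<close>

lemma mat_adjoint_index: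
  "i < dim_col A \<Longrightarrow> j < dim_row A \<Longrightarrow> mat_adjoint A $$ (i, j) = conjugate (A $$ (j, i))"
  by (simp add: mat_adjoint_def mat_of_rows_index)

lemma mat_adjoint_dim:
  "dim_row (mat_adjoint A) = dim_col A" "dim_col (mat_adjoint A) = dim_row A"
  by (simp_all add: mat_adjoint_def)

lemma tensor_mat_index:
  assumes "x < dim_row M" "z < dim_row N" "y < dim_col M" "w < dim_col N"
  shows "tensor_mat M N $$ (x * dim_row N + z, y * dim_col N + w) = M $$ (x, y) * N $$ (z, w)"
  using assms by (simp add: tensor_mat_def index_less)

text \<open>The identity on BE fixes the index of E, so for each \<open>e\<close> the slice of
  amplitudes is transformed by \<open>tensor_mat V (1\<^sub>m dB)\<close>, the same matrix that acts
  in \<open>split_state\<close>.\<close>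

lemma tensor_id_index:
  assumes V: "V \<in> carrier_mat n m" and \<psi>: "\<psi> \<in> carrier_vec (m * dB * dE)"
    and i: "i < n * dB" and e: "e < dE"
  shows "(tensor_mat V (1\<^sub>m (dB * dE)) *\<^sub>v \<psi>) $ (i * dE + e)
    = (\<Sum>j<m * dB. tensor_mat V (1\<^sub>m dB) $$ (i, j) * \<psi> $ (j * dE + e))"
proof -
  have T: "tensor_mat V (1\<^sub>m (dB * dE)) $$ (i * dE + e, j * dE + e')
      = (if e' = e then tensor_mat V (1\<^sub>m dB) $$ (i, j) else 0)"
    if j: "j < m * dB" and e': "e' < dE" for j e'
  proof -
    obtain x b where x: "x < n" "b < dB" "i = x * dB + b" using i by (rule index_cases)
    obtain y c where y: "y < m" "c < dB" "j = y * dB + c" using j by (rule index_cases)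
    have lt: "b * dE + e < dB * dE" "c * dE + e' < dB * dE"
      using x y e e' by (auto intro: index_less)
    have "b * dE + e = c * dE + e' \<longleftrightarrow> b = c \<and> e = e'"
      using e e' by (metis div_mult_self3 div_less add_0_right mod_mult_self3 mod_less
          mod_less_divisor less_nat_zero_code)
    then have "tensor_mat V (1\<^sub>m (dB * dE))
        $$ (x * (dB * dE) + (b * dE + e), y * (dB * dE) + (c * dE + e'))
      = (if e' = e then tensor_mat V (1\<^sub>m dB) $$ (x * dB + b, y * dB + c) else 0)"
      using V x y lt tensor_mat_index[of x V "b * dE + e" "1\<^sub>m (dB * dE)" y "c * dE + e'"]
        tensor_mat_index[of x V b "1\<^sub>m dB" y c]
      by auto
    then show ?thesis by (simp only: x y index_assoc)
  qed
  have "(tensor_mat V (1\<^sub>m (dB * dE)) *\<^sub>v \<psi>) $ (i * dE + e)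
    = (\<Sum>j<m * dB * dE. tensor_mat V (1\<^sub>m (dB * dE)) $$ (i * dE + e, j) * \<psi> $ j)"
    using V \<psi> index_less[OF i e]
    by (simp add: tensor_mat_def scalar_prod_def atLeast0LessThan mult.assoc)
  also have "\<dots> = (\<Sum>j<m * dB. tensor_mat V (1\<^sub>m dB) $$ (i, j) * \<psi> $ (j * dE + e))"
    unfolding sum_index[of _ "m * dB" dE]
  proof (intro sum.cong refl)
    fix j assume "j \<in> {..<m * dB}"
    then have "(\<Sum>y<dE. tensor_mat V (1\<^sub>m (dB * dE)) $$ (i * dE + e, j * dE + y) * \<psi> $ (j * dE + y))
      = (\<Sum>y<dE. if y = e then tensor_mat V (1\<^sub>m dB) $$ (i, j) * \<psi> $ (j * dE + e) else 0)"
      by (intro sum.cong) (auto simp: T)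
    then show "(\<Sum>y<dE. tensor_mat V (1\<^sub>m (dB * dE)) $$ (i * dE + e, j * dE + y) * \<psi> $ (j * dE + y))
      = tensor_mat V (1\<^sub>m dB) $$ (i, j) * \<psi> $ (j * dE + e)"
      using e by simp
  qed
  finally show ?thesis .
qed

text \<open>The amplitudes of \<open>\<psi>\<close>, read as a matrix \<open>?M\<close> with rows AB
  and columns E, satisfy \<open>\<rho> = ?M * ?M'\<close>. Conjugation by \<open>?U\<close> replaces
  \<open>?M\<close> by \<open>?U * ?M\<close>, which is the amplitude matrix of
  \<open>\<Psi>\<close>.\<close>

lemma split_state_purification:
  assumes V: "V \<in> carrier_mat n dA" and pur: "purification dA dB dE \<psi> \<rho>"
  defines "\<Psi> \<equiv> tensor_mat V (1\<^sub>m (dB * dE)) *\<^sub>v \<psi>"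
  shows "split_state dB V \<rho> = mat (n * dB) (n * dB)
    (\<lambda>(i, j). \<Sum>e<dE. \<Psi> $ (i * dE + e) * cnj (\<Psi> $ (j * dE + e)))"
proof -
  let ?U = "tensor_mat V (1\<^sub>m dB)"
  let ?M = "mat (dA * dB) dE (\<lambda>(j, e). \<psi> $ (j * dE + e))"
  let ?M' = "mat dE (dA * dB) (\<lambda>(e, j). cnj (\<psi> $ (j * dE + e)))"
  have \<psi>: "\<psi> \<in> carrier_vec (dA * dB * dE)" and \<rho>: "\<rho> = ptrace (dA * dB) dE 1 (proj_mat \<psi>)"
    using pur by (auto simp: purification_def)
  have U: "?U \<in> carrier_mat (n * dB) (dA * dB)" using V by (simp add: tensor_mat_def)
  have U': "mat_adjoint ?U \<in> carrier_mat (dA * dB) (n * dB)"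
    using U by (auto simp: mat_adjoint_dim)
  have \<rho>M: "\<rho> = ?M * ?M'"
  proof (rule eq_matI)
    fix i j assume "i < dim_row (?M * ?M')" "j < dim_col (?M * ?M')"
    then have ij: "i < dA * dB" "j < dA * dB" by auto
    then show "\<rho> $$ (i, j) = (?M * ?M') $$ (i, j)"
      using \<psi> unfolding \<rho>
      by (subst ptrace_index_last) (auto simp: proj_mat_def scalar_prod_def atLeast0LessThan index_less)
  qed (auto simp: \<rho>)
  note \<Psi> = tensor_id_index[OF V \<psi>, folded \<Psi>_def]
  have UM: "?U * ?M = mat (n * dB) dE (\<lambda>(i, e). \<Psi> $ (i * dE + e))"
    by (rule eq_matI) (use U in \<open>auto simp: \<Psi> scalar_prod_def atLeast0LessThan\<close>)
  have MU: "?M' * mat_adjoint ?U = mat dE (n * dB) (\<lambda>(e, j). cnj (\<Psi> $ (j * dE + e)))"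
    by (rule eq_matI)
      (use U U' in \<open>auto simp: \<Psi> scalar_prod_def atLeast0LessThan mat_adjoint_index mult.commute\<close>)
  have "split_state dB V \<rho> = ?U * (?M * ?M') * mat_adjoint ?U"
    by (simp only: split_state_def Let_def \<rho>M)
  also have "?U * (?M * ?M') = ?U * ?M * ?M'"
    by (rule assoc_mult_mat[symmetric, OF U]) auto
  also have "\<dots> * mat_adjoint ?U = (?U * ?M) * (?M' * mat_adjoint ?U)"
    by (rule assoc_mult_mat[OF _ _ U']) (use U in auto)
  also have "\<dots> = mat (n * dB) (n * dB)
    (\<lambda>(i, j). \<Sum>e<dE. \<Psi> $ (i * dE + e) * cnj (\<Psi> $ (j * dE + e)))"
    unfolding UM MU by (rule eq_matI) (auto simp: scalar_prod_def atLeast0LessThan)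
  finally show ?thesis .
qed

section \<open>The marginals of the split pure state\<close>

text \<open>The equality S(\<alpha>B) = S(aE) for the cut \<alpha>B | aE of the vector
  \<open>\<Psi>\<close>.\<close>

lemma vn_entropy_ptrace_first_purification:
  assumes \<Psi>: "\<Psi> \<in> carrier_vec (da * d\<alpha> * dB * dE)"
  shows "vn_entropy (ptrace 1 da (d\<alpha> * dB) (mat (da * d\<alpha> * dB) (da * d\<alpha> * dB)
      (\<lambda>(i, j). \<Sum>e<dE. \<Psi> $ (i * dE + e) * cnj (\<Psi> $ (j * dE + e)))))
    = vn_entropy (marginal_aE da d\<alpha> dB dE (proj_mat \<Psi>))"
    (is "vn_entropy ?L = vn_entropy ?R")
proof -
  \<comment> \<open>Amplitudes as a matrix with rows aE and columns \<alpha>B. Since a and E are not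
    adjacent in the flat order, the row index is taken apart by \<open>div\<close> and
    \<open>mod\<close>.\<close>
  define g where "g i r = \<Psi> $ ((i div dE * (d\<alpha> * dB) + r) * dE + i mod dE)" for i r
  have "?R = mat (da * dE) (da * dE) (\<lambda>(i, j). \<Sum>r<d\<alpha> * dB. g i r * cnj (g j r))"
  proof (rule eq_matI, goal_cases)
    case (1 i j)
    from 1 have "i < da * dE" "j < da * dE" by auto
    then show ?case
      by (elim index_cases)
        (simp add: marginal_aE_index[OF \<Psi>] index_less g_def sum_index index_assoc)
  qed (auto simp: marginal_aE_def)
  moreover have "?L = mat (d\<alpha> * dB) (d\<alpha> * dB) (\<lambda>(r, s). \<Sum>i<da * dE. g i r * cnj (g i s))"
  proof (rule eq_matI, goal_cases)
    case (1 r s)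
    then show ?case
      by (subst ptrace_index_first)
        (auto simp: sum_index[of _ da dE] g_def index_less mult.assoc[of da])
  qed auto
  ultimately show ?thesis
    using vn_entropy_complementary[where m = "da * dE" and n = "d\<alpha> * dB" and g = g] by simp
qed

text \<open>Brings the marginal on E into the form in which it appears as a diagonal block of the
  Gram matrix in \<open>vn_entropy_erasure_output\<close>.\<close>

lemma ptrace_marginal_aE_first:
  assumes \<Psi>: "\<Psi> \<in> carrier_vec (da * d\<alpha> * dB * dE)"
  shows "ptrace 1 da dE (marginal_aE da d\<alpha> dB dE (proj_mat \<Psi>)) = mat dE dE
    (\<lambda>(e, e'). \<Sum>i<da * d\<alpha> * dB. \<Psi> $ (i * dE + e) * cnj (\<Psi> $ (i * dE + e')))"
proof (rule eq_matI, goal_cases)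
  case (1 e e')
  then show ?case
    by (subst ptrace_index_first) (auto simp: marginal_aE_index[OF \<Psi>] sum_index)
qed auto

lemma ptrace_marginal_aB_first:
  assumes \<Psi>: "\<Psi> \<in> carrier_vec (da * d\<alpha> * dB * dE)"
  shows "ptrace 1 da dB (marginal_aB da d\<alpha> dB dE (proj_mat \<Psi>))
    = ptrace 1 (da * d\<alpha>) dB (mat (da * d\<alpha> * dB) (da * d\<alpha> * dB)
      (\<lambda>(i, j). \<Sum>e<dE. \<Psi> $ (i * dE + e) * cnj (\<Psi> $ (j * dE + e))))"
proof (rule eq_matI, goal_cases)
  case (1 b b')
  then have "b < dB" "b' < dB" by auto
  then show ?case
    by (simp add: ptrace_index_first[unfolded One_nat_def] marginal_aB_index[OF \<Psi>] sum_index
        index_less sum.swap[of _ "{..<dE}" "{..<d\<alpha>}"])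
qed auto

text \<open>Both sides are the marginal on a, summed in different orders. Hence S(a) cancels in
  I(a:B) - I(a:E).\<close>

lemma ptrace_marginals_last:
  assumes \<Psi>: "\<Psi> \<in> carrier_vec (da * d\<alpha> * dB * dE)"
  shows "ptrace da dB 1 (marginal_aB da d\<alpha> dB dE (proj_mat \<Psi>))
    = ptrace da dE 1 (marginal_aE da d\<alpha> dB dE (proj_mat \<Psi>))"
proof (rule eq_matI, goal_cases)
  case (1 x x')
  then have x: "x < da" "x' < da" by auto
  let ?f = "\<lambda>k b e. \<Psi> $ (((x * d\<alpha> + k) * dB + b) * dE + e) * cnj (\<Psi> $ (((x' * d\<alpha> + k) * dB + b) * dE + e))"
  have "(\<Sum>b<dB. \<Sum>e<dE. \<Sum>k<d\<alpha>. ?f k b e) = (\<Sum>e<dE. \<Sum>b<dB. \<Sum>k<d\<alpha>. ?f k b e)"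
    by (rule sum.swap)
  also have "\<dots> = (\<Sum>e<dE. \<Sum>k<d\<alpha>. \<Sum>b<dB. ?f k b e)"
    by (intro sum.cong refl sum.swap)
  finally show ?case
    using x by (simp add: ptrace_index_last[unfolded One_nat_def] marginal_aB_index[OF \<Psi>]
        marginal_aE_index[OF \<Psi>])
qed auto

section \<open>Entropies of the erasure output\<close>

lemma ptrace_erasure_output_first:
  assumes \<sigma>: "split_state dB V \<rho> = \<sigma>" "\<sigma> \<in> carrier_mat (da * d\<alpha> * dB) (da * d\<alpha> * dB)"
  shows "ptrace 1 da ((d\<alpha> + 1) * dB) (erasure_output dB da d\<alpha> V \<rho>)
    = (1 / 2) \<cdot>\<^sub>m four_block_mat (ptrace 1 da (d\<alpha> * dB) \<sigma>) (0\<^sub>m (d\<alpha> * dB) dB)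
        (0\<^sub>m dB (d\<alpha> * dB)) (ptrace 1 (da * d\<alpha>) dB \<sigma>)"
    (is "?L = _ \<cdot>\<^sub>m four_block_mat ?A _ _ ?B")
proof (rule eq_matI, goal_cases)
  case (1 i j)
  then have i: "i < (d\<alpha> + 1) * dB" and j: "j < (d\<alpha> + 1) * dB" by auto
  obtain k b where kb: "k < d\<alpha> + 1" "b < dB" "i = k * dB + b"
    using i by (rule index_cases)
  obtain k' b' where kb': "k' < d\<alpha> + 1" "b' < dB" "j = k' * dB + b'"
    using j by (rule index_cases)
  note ij = kb kb'
  \<comment> \<open>The flag is the last basis vector of B' and B is the minor index, so the flag
    rows are exactly those from \<open>d\<alpha> * dB\<close> on, and the block form needs no
    permutation.\<close>
  have b1: "k * dB + b < d\<alpha> * dB \<longleftrightarrow> k < d\<alpha>" "k' * dB + b' < d\<alpha> * dB \<longleftrightarrow> k' < d\<alpha>"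
    using ij index_less[of k d\<alpha> b dB] index_less[of k' d\<alpha> b' dB] mult_le_mono1[of d\<alpha> k dB] mult_le_mono1[of d\<alpha> k' dB]
    by (meson not_less trans_le_add1)+
  have "?L $$ (i, j) = (\<Sum>x<da. erasure_output dB da d\<alpha> V \<rho>
      $$ ((x * (d\<alpha> + 1) + k) * dB + b, (x * (d\<alpha> + 1) + k') * dB + b'))"
    using i j unfolding ij by (subst ptrace_index_first) (simp_all only: index_assoc)
  also have "\<dots> = (\<Sum>x<da. if k < d\<alpha> \<and> k' < d\<alpha> then \<sigma> $$ ((x * d\<alpha> + k) * dB + b, (x * d\<alpha> + k') * dB + b') / 2
       else if k = d\<alpha> \<and> k' = d\<alpha>
       then (\<Sum>l<d\<alpha>. \<sigma> $$ ((x * d\<alpha> + l) * dB + b, (x * d\<alpha> + l) * dB + b')) / 2 else 0)"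
    using ij by (intro sum.cong refl) (subst erasure_output_index, auto simp: \<sigma>)
  also have "\<dots> = (1 / 2 \<cdot>\<^sub>m four_block_mat ?A (0\<^sub>m (d\<alpha> * dB) dB) (0\<^sub>m dB (d\<alpha> * dB)) ?B) $$ (i, j)"
    using ij b1 i j
    by (auto simp: ptrace_index_first[unfolded One_nat_def] index_assoc sum_divide_distrib[symmetric] sum_index
        not_less index_less less_Suc_eq split: if_splits)
  finally show ?case .
qed auto

text \<open>
  The proof writes \<open>\<Omega> = G G\<^sup>* / 2\<close>, where the columns of \<open>G\<close> are indexed by \<open>E\<close> (nothing erased)
  followed by \<open>\<alpha>E\<close> (\<open>\<alpha>\<close> erased). Since the flag separates the two branches, \<open>G\<^sup>* G\<close> is block
  diagonal, with blocks the marginals on \<open>E\<close> and on \<open>\<alpha>E\<close>; the latter is complementary to \<open>aB\<close>.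
\<close>

lemma vn_entropy_erasure_output:
  assumes \<Psi>: "\<Psi> \<in> carrier_vec (da * d\<alpha> * dB * dE)"
    and \<sigma>: "split_state dB V \<rho> = mat (da * d\<alpha> * dB) (da * d\<alpha> * dB)
      (\<lambda>(i, j). \<Sum>e<dE. \<Psi> $ (i * dE + e) * cnj (\<Psi> $ (j * dE + e)))"
  defines "\<Omega> \<equiv> erasure_output dB da d\<alpha> V \<rho>"
  shows "vn_entropy \<Omega> = (vn_entropy (ptrace 1 da dE (marginal_aE da d\<alpha> dB dE (proj_mat \<Psi>)))
      + vn_entropy (marginal_aB da d\<alpha> dB dE (proj_mat \<Psi>))) / 2 + Re (mat_trace \<Omega>)"
proof -
  define N where "N = da * (d\<alpha> + 1) * dB"
  \<comment> \<open>\<open>g\<close> is the matrix G. A column \<open>c < dE\<close> is an index of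
    E and meets only rows without the flag. A later column encodes a pair from \<alpha>E as
    \<open>c - dE\<close> and meets only flag rows, where the lost index of \<alpha> is read off
    from the column.\<close>
  define g where "g i c =
    (let x = i div dB div (d\<alpha> + 1); k = i div dB mod (d\<alpha> + 1); b = i mod dB in
      if k < d\<alpha> then if c < dE then \<Psi> $ (((x * d\<alpha> + k) * dB + b) * dE + c) else 0
      else if c < dE then 0
      else \<Psi> $ (((x * d\<alpha> + (c - dE) div dE) * dB + b) * dE + (c - dE) mod dE))" for i c
  have g: "g ((x * (d\<alpha> + 1) + k) * dB + b) c =
      (if k < d\<alpha> then if c < dE then \<Psi> $ (((x * d\<alpha> + k) * dB + b) * dE + c) else 0
      else if c < dE then 0
      else \<Psi> $ (((x * d\<alpha> + (c - dE) div dE) * dB + b) * dE + (c - dE) mod dE))"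
    if "k < d\<alpha> + 1" "b < dB" for x k b c
  proof -
    have "((x * (d\<alpha> + 1) + k) * dB + b) div dB = x * (d\<alpha> + 1) + k"
      "((x * (d\<alpha> + 1) + k) * dB + b) mod dB = b"
      "(x * (d\<alpha> + 1) + k) div (d\<alpha> + 1) = x" "(x * (d\<alpha> + 1) + k) mod (d\<alpha> + 1) = k"
      using that by (simp_all del: mult_Suc_right add: div_mult_self3 mod_mult_self3)
    then show ?thesis unfolding g_def Let_def by simp
  qed
  let ?O = "mat N N (\<lambda>(i, j). \<Sum>c<dE + d\<alpha> * dE. g i c * cnj (g j c))"
  \<comment> \<open>The amplitudes once more, now as a matrix with rows aB and columns \<alpha>E. It
    is the erased branch of \<open>g\<close> and shows that \<open>?K\<close> is complementary to
    the marginal on aB.\<close>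
  define h where "h i r = \<Psi> $ (((i div dB * d\<alpha> + r div dE) * dB + i mod dB) * dE + r mod dE)" for i r
  let ?E = "ptrace 1 da dE (marginal_aE da d\<alpha> dB dE (proj_mat \<Psi>))"
  let ?K = "mat (d\<alpha> * dE) (d\<alpha> * dE) (\<lambda>(r, s). \<Sum>i<da * dB. h i r * cnj (h i s))"
  have \<Omega>: "\<Omega> = (1 / 2) \<cdot>\<^sub>m ?O"
  proof (rule eq_matI, goal_cases)
    case (1 i j)
    then have i: "i < da * (d\<alpha> + 1) * dB" and j: "j < da * (d\<alpha> + 1) * dB"
      by (auto simp: N_def)
    obtain y b where y: "y < da * (d\<alpha> + 1)" "b < dB" "i = y * dB + b"
      using i by (rule index_cases)
    obtain y' b' where y': "y' < da * (d\<alpha> + 1)" "b' < dB" "j = y' * dB + b'"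
      using j by (rule index_cases)
    obtain x k where x: "x < da" "k < d\<alpha> + 1" "y = x * (d\<alpha> + 1) + k"
      using y(1) by (rule index_cases)
    obtain x' k' where x': "x' < da" "k' < d\<alpha> + 1" "y' = x' * (d\<alpha> + 1) + k'"
      using y'(1) by (rule index_cases)
    note gi = g[OF x(2) y(2), of x, folded x(3), folded y(3)]
      and gj = g[OF x'(2) y'(2), of x', folded x'(3), folded y'(3)]
    note \<Omega>ij = erasure_output_index[OF x(1) x'(1) x(2) x'(2) y(2) y'(2), of V \<rho>,
        folded x(3) x'(3), folded y(3) y'(3), folded \<Omega>_def]
    have "\<Omega> $$ (i, j) = (\<Sum>c<dE + d\<alpha> * dE. g i c * cnj (g j c)) / 2"
      unfolding \<Omega>ij \<sigma> sum_index_split gi gj using x(1,2) x'(1,2) y(2) y'(2)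
      by (auto simp: sum_index index_less less_Suc_eq)
    then show ?case using 1 by (auto simp: N_def)
  qed (auto simp: \<Omega>_def erasure_output_def apply_middle_def N_def)
  have blocks: "mat (dE + d\<alpha> * dE) (dE + d\<alpha> * dE) (\<lambda>(c, d). \<Sum>i<N. g i c * cnj (g i d))
    = four_block_mat ?E (0\<^sub>m dE (d\<alpha> * dE)) (0\<^sub>m (d\<alpha> * dE) dE) ?K"
  proof (rule eq_matI, goal_cases)
    case (1 c d)
    \<comment> \<open>The term of the flag, the last value of \<open>k\<close>, is split off: it
      feeds only the block of \<alpha>E, and the other terms feed only the block of E.\<close>
    have "(\<Sum>i<N. g i c * cnj (g i d)) = (\<Sum>x<da.
       (\<Sum>k<d\<alpha>. \<Sum>b<dB. g ((x * (d\<alpha> + 1) + k) * dB + b) c * cnj (g ((x * (d\<alpha> + 1) + k) * dB + b) d))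
       + (\<Sum>b<dB. g ((x * (d\<alpha> + 1) + d\<alpha>) * dB + b) c * cnj (g ((x * (d\<alpha> + 1) + d\<alpha>) * dB + b) d)))"
      unfolding N_def by (simp only: sum_index Suc_eq_plus1[symmetric] sum.lessThan_Suc)
    also have "\<dots> = (\<Sum>x<da.
       (\<Sum>k<d\<alpha>. \<Sum>b<dB. if c < dE \<and> d < dE then \<Psi> $ (((x * d\<alpha> + k) * dB + b) * dE + c)
          * cnj (\<Psi> $ (((x * d\<alpha> + k) * dB + b) * dE + d)) else 0)
       + (\<Sum>b<dB. if c < dE \<or> d < dE then 0 else h (x * dB + b) (c - dE) * cnj (h (x * dB + b) (d - dE))))"
      by (intro sum.cong arg_cong2[of _ _ _ _ "(+)"] refl; subst (1 2) g) (auto simp: h_def)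
    also have "\<dots> = four_block_mat ?E (0\<^sub>m dE (d\<alpha> * dE)) (0\<^sub>m (d\<alpha> * dE) dE) ?K $$ (c, d)"
      using 1 by (auto simp: ptrace_marginal_aE_first[OF \<Psi>, unfolded One_nat_def] sum_index)
    finally show ?case using 1 by simp
  qed auto
  have aB: "marginal_aB da d\<alpha> dB dE (proj_mat \<Psi>)
    = mat (da * dB) (da * dB) (\<lambda>(i, j). \<Sum>r<d\<alpha> * dE. h i r * cnj (h j r))"
  proof (rule eq_matI, goal_cases)
    case (1 i j)
    from 1 have "i < da * dB" "j < da * dB" by auto
    then show ?case
      by (elim index_cases) (simp add: marginal_aB_index[OF \<Psi>] index_less h_def sum_index
          sum.swap[of _ "{..<dE}" "{..<d\<alpha>}"])
  qed (auto simp: marginal_aB_def)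
  have "vn_entropy ?O = vn_entropy ?E + vn_entropy ?K"
    by (rule trans[OF vn_entropy_complementary], unfold blocks, rule vn_entropy_block_diag) auto
  also have "vn_entropy ?K = vn_entropy (marginal_aB da d\<alpha> dB dE (proj_mat \<Psi>))"
    unfolding aB by (rule vn_entropy_complementary[symmetric])
  finally show ?thesis
    unfolding \<Omega> by (subst vn_entropy_half[of _ N]) (auto simp: mat_trace_def sum_distrib_left sum_divide_distrib[symmetric])
qed

lemma coherent_information_erasure_output:
  assumes V: "V \<in> carrier_mat (da * d\<alpha>) dA" and pur: "purification dA dB dE \<psi> \<rho>"
  shows "coherent_information da ((d\<alpha> + 1) * dB) (erasure_output dB da d\<alpha> V \<rho>)
    = half_information_gap da d\<alpha> dB dE (split_pure dB dE V \<psi>)"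
proof -
  define \<Psi> where "\<Psi> = tensor_mat V (1\<^sub>m (dB * dE)) *\<^sub>v \<psi>"
  have \<Psi>: "\<Psi> \<in> carrier_vec (da * d\<alpha> * dB * dE)"
    using V by (simp add: carrier_dim_vec \<Psi>_def tensor_mat_def mult.assoc)
  note \<sigma> = split_state_purification[OF V pur, folded \<Psi>_def]
  let ?\<sigma> = "mat (da * d\<alpha> * dB) (da * d\<alpha> * dB)
      (\<lambda>(i, j). \<Sum>e<dE. \<Psi> $ (i * dE + e) * cnj (\<Psi> $ (j * dE + e)))"
  let ?\<Omega> = "erasure_output dB da d\<alpha> V \<rho>"
  let ?T = "four_block_mat (ptrace 1 da (d\<alpha> * dB) ?\<sigma>) (0\<^sub>m (d\<alpha> * dB) dB)
        (0\<^sub>m dB (d\<alpha> * dB)) (ptrace 1 (da * d\<alpha>) dB ?\<sigma>)"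
  let ?aB = "marginal_aB da d\<alpha> dB dE (proj_mat \<Psi>)" and ?aE = "marginal_aE da d\<alpha> dB dE (proj_mat \<Psi>)"
  have tr: "ptrace 1 da ((d\<alpha> + 1) * dB) ?\<Omega> = (1 / 2) \<cdot>\<^sub>m ?T"
    by (rule ptrace_erasure_output_first[OF \<sigma>]) auto
  have T: "?T \<in> carrier_mat (d\<alpha> * dB + dB) (d\<alpha> * dB + dB)" by auto
  \<comment> \<open>The partial trace preserves the trace, so halving adds the same term
    \<open>Re (mat_trace ?\<Omega>)\<close> to S(BB') as to S(aBB'). The two cancel in the coherent
    information.\<close>
  have "mat_trace (ptrace 1 da ((d\<alpha> + 1) * dB) ?\<Omega>) = mat_trace ?\<Omega>"
    by (rule mat_trace_ptrace_first)
      (auto simp: erasure_output_def apply_middle_def algebra_simps)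
  then have "Re (mat_trace ?T) / 2 = Re (mat_trace ?\<Omega>)"
    unfolding tr by (simp add: mat_trace_def sum_divide_distrib[symmetric] flip: sum_distrib_left)
  then have "vn_entropy (ptrace 1 da ((d\<alpha> + 1) * dB) ?\<Omega>)
    = (vn_entropy (ptrace 1 da (d\<alpha> * dB) ?\<sigma>) + vn_entropy (ptrace 1 (da * d\<alpha>) dB ?\<sigma>)) / 2
      + Re (mat_trace ?\<Omega>)"
    unfolding tr vn_entropy_half[OF T]
    by (subst vn_entropy_block_diag[of _ "d\<alpha> * dB" _ dB]) auto
  also have "\<dots> = (vn_entropy ?aE + vn_entropy (ptrace 1 da dB ?aB)) / 2 + Re (mat_trace ?\<Omega>)"
    by (simp only: vn_entropy_ptrace_first_purification[OF \<Psi>] ptrace_marginal_aB_first[OF \<Psi>])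
  finally show ?thesis
    unfolding coherent_information_def half_information_gap_def mutual_information_def
      split_pure_def \<Psi>_def[symmetric] vn_entropy_erasure_output[OF \<Psi> \<sigma>] ptrace_marginals_last[OF \<Psi>]
    by (simp add: field_simps)
qed

section \<open>Equality of the suprema\<close>

theorem proposition9:
  fixes dA dB dE :: nat and \<rho> :: "complex mat" and \<psi> :: "complex vec"
  assumes "density_operator (dA * dB) \<rho>"
    and "purification dA dB dE \<psi> \<rho>"
  shows "D_erasure dA dB \<rho> = W_ind dA dB \<rho>
    \<and> W_ind dA dB \<rho> = (SUP (da, d\<alpha>, V)\<in>splittings dA.
         ereal (half_information_gap da d\<alpha> dB dE (split_pure dB dE V \<psi>)))"
proof -
  \<comment> \<open>Proved for every purification, because it is applied both to the given one and
    to the one selected inside \<open>W_ind\<close>.\<close>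
  have D: "D_erasure dA dB \<rho> = (SUP (da, d\<alpha>, V)\<in>splittings dA.
         ereal (half_information_gap da d\<alpha> dB dE (split_pure dB dE V \<psi>)))"
    if "purification dA dB dE \<psi> \<rho>" for dE \<psi>
    unfolding D_erasure_def
    by (rule SUP_cong) (auto simp: splittings_def coherent_information_erasure_output[OF _ that, simplified])
  obtain dE' \<psi>' where p: "(SOME p. purification dA dB (fst p) (snd p) \<rho>) = (dE', \<psi>')"
    by (meson surj_pair)
  \<comment> \<open>The given purification witnesses existence, so the selected pair is a
    purification of the same state.\<close>
  have "purification dA dB dE' \<psi>' \<rho>"
    using someI[of "\<lambda>p. purification dA dB (fst p) (snd p) \<rho>" "(dE, \<psi>)"] assms(2) by (simp add: p)
  then have "D_erasure dA dB \<rho> = W_ind dA dB \<rho>"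
    unfolding W_ind_def p by (simp add: D)
  then show ?thesis using D[OF assms(2)] by simp
qed

end
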